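(* There is an algorithm which, given query access to $f:\{-1,1\}^n\to\{-1,1\}$, a noise rate $p\in(0,1)$, an accuracy parameter $\tau\in(0,1)$ and a confidence parameter $\delta\in(0,1)$, for $q=O\big((\log n+\log(1/\delta))/\tau^2\big)$ makes $O(q)$ queries to $f$, runs in $O(qn)$ time, and returns estimates $\eta_1,\dots,\eta_n$ such that with probability at least $1-\delta$, $|\eta_i-\mathrm{Score}_i(f,p)|<\tau$ for all $i\in[n]$.
   Context: For $\mathbf{x}$ uniform on $\{-1,1\}^n$, a $p$-noisy copy $\mathbf{y}$ of $\mathbf{x}$ rerandomizes each coordinate independently with probability $p$; $\mathrm{NS}_p(f)=\Pr[f(\mathbf{x})\ne f(\mathbf{y})]$. $\mathrm{Score}_i(f,p)=\mathrm{NS}_p(f)-\mathbb{E}_{\mathbf{b}\in\{-1,1\}}[\mathrm{NS}_p(f_{x_i=\mathbf{b}})]$, where $f_{x_i=b}$ is the restriction setting $x_i=b$ and $\mathbf{b}$ is uniform. *)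

theory Defs
  imports "HOL-Probability.Probability" "HOL-Probability.Product_PMF"
begin

section \<open>Noise sensitivity and scores\<close>

text \<open>
  Points of \<open>{-1,1}\<^sup>n\<close> are extensional functions on \<open>{1..n}\<close>, i.e. \<^const>\<open>undefined\<close>
  elsewhere; \<^const>\<open>undefined\<close> is therefore also the default value given to \<^const>\<open>Pi_pmf\<close>.
\<close>

definition cube :: "nat \<Rightarrow> (nat \<Rightarrow> real) set" where
  "cube n = {1..n} \<rightarrow>\<^sub>E {-1, 1}"

definition noisy_copy :: "nat \<Rightarrow> real \<Rightarrow> (nat \<Rightarrow> real) \<Rightarrow> (nat \<Rightarrow> real) pmf" where
  "noisy_copy n p x = Pi_pmf {1..n} undefined (\<lambda>i.
     bind_pmf (bernoulli_pmf p) (\<lambda>rerandomize.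
       if rerandomize then pmf_of_set {-1, 1} else return_pmf (x i)))"

definition noisy_pair :: "nat \<Rightarrow> real \<Rightarrow> ((nat \<Rightarrow> real) \<times> (nat \<Rightarrow> real)) pmf" where
  "noisy_pair n p =
     bind_pmf (pmf_of_set (cube n)) (\<lambda>x. map_pmf (\<lambda>y. (x, y)) (noisy_copy n p x))"

definition NS :: "nat \<Rightarrow> real \<Rightarrow> ((nat \<Rightarrow> real) \<Rightarrow> real) \<Rightarrow> real" where
  "NS n p f = measure_pmf.prob (noisy_pair n p) {(x, y). f x \<noteq> f y}"

text \<open>
  The restriction \<open>f\<^bsub>x\<^sub>i=b\<^esub>\<close> is kept as a function on all of \<open>{-1,1}\<^sup>n\<close> that ignores
  coordinate \<open>i\<close>.
\<close>

definition restriction ::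
    "((nat \<Rightarrow> real) \<Rightarrow> real) \<Rightarrow> nat \<Rightarrow> real \<Rightarrow> (nat \<Rightarrow> real) \<Rightarrow> real" where
  "restriction f i b = (\<lambda>x. f (x(i := b)))"

definition Score :: "nat \<Rightarrow> ((nat \<Rightarrow> real) \<Rightarrow> real) \<Rightarrow> real \<Rightarrow> nat \<Rightarrow> real" where
  "Score n f p i =
     NS n p f - measure_pmf.expectation (pmf_of_set {-1, 1}) (\<lambda>b. NS n p (restriction f i b))"

section \<open>Randomized query algorithms\<close>

text \<open>
  Algorithms are programs of a small structured language for a randomized unit-cost real RAM.
  There are natural-number variables (for counters and addresses), real variables, and arrays
  of reals indexed by natural numbers. Exact real arithmetic and comparisons are available, but
  no rounding of reals to integers, and no multiplication of natural numbers. The only literals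
  are integers, so that a program cannot carry infinite advice in a real constant.

  Expressions are evaluated at unit cost. This changes running times only by a constant factor,
  since a fixed program contains finitely many expressions of fixed size.
\<close>

datatype nexp =
    NConst nat
  | NVar string
  | NAdd nexp nexp
  | NSub nexp nexp

datatype rexp =
    RConst int
  | RVar string
  | RArr string nexp
  | RNat nexp
  | RAdd rexp rexp
  | RSub rexp rexp
  | RMul rexp rexp
  | RDiv rexp rexp

datatype bexp =
    NLess nexp nexp
  | RLess rexp rexp
  | BNot bexp
  | BAnd bexp bexp

text \<open>
  \<open>Flip v e\<close> sets \<open>v\<close> to \<open>1\<close> with the probability given by \<open>e\<close> (truncated to \<open>[0,1]\<close>) and to \<open>0\<close>
  otherwise, using fresh randomness. \<open>Query v a\<close> stores in \<open>v\<close> the value of the queried function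
  at the point held in array \<open>a\<close>.
\<close>

datatype com =
    Skip
  | NAssign string nexp
  | RAssign string rexp
  | Store string nexp rexp
  | Flip string rexp
  | Query string string
  | Seq com com
  | If bexp com com
  | While bexp com

text \<open>The field \<open>queries\<close> counts the queries made so far; programs have no access to it.\<close>

record state =
  nvar :: "string \<Rightarrow> nat"
  rvar :: "string \<Rightarrow> real"
  arr :: "string \<Rightarrow> nat \<Rightarrow> real"
  queries :: nat

fun nval :: "nexp \<Rightarrow> state \<Rightarrow> nat" where
  "nval (NConst k) s = k"
| "nval (NVar v) s = nvar s v"
| "nval (NAdd a b) s = nval a s + nval b s"
| "nval (NSub a b) s = nval a s - nval b s"

fun rval :: "rexp \<Rightarrow> state \<Rightarrow> real" where
  "rval (RConst k) s = of_int k"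
| "rval (RVar v) s = rvar s v"
| "rval (RArr a e) s = arr s a (nval e s)"
| "rval (RNat e) s = real (nval e s)"
| "rval (RAdd a b) s = rval a s + rval b s"
| "rval (RSub a b) s = rval a s - rval b s"
| "rval (RMul a b) s = rval a s * rval b s"
| "rval (RDiv a b) s = rval a s / rval b s"

fun bval :: "bexp \<Rightarrow> state \<Rightarrow> bool" where
  "bval (NLess a b) s = (nval a s < nval b s)"
| "bval (RLess a b) s = (rval a s < rval b s)"
| "bval (BNot b) s = (\<not> bval b s)"
| "bval (BAnd a b) s = (bval a s \<and> bval b s)"

text \<open>
  The reply to a query is \<open>f x\<close> if the array holds a point \<open>x\<close> of \<open>{-1,1}\<^sup>n\<close> in its cells
  \<open>1, \<dots>, n\<close>. Values of \<open>f\<close> outside the cube are never revealed.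
\<close>

definition reply :: "nat \<Rightarrow> ((nat \<Rightarrow> real) \<Rightarrow> real) \<Rightarrow> (nat \<Rightarrow> real) \<Rightarrow> real" where
  "reply n f a = (let x = restrict a {1..n} in if x \<in> cube n then f x else 0)"

text \<open>
  Small-step semantics; the parameter \<open>Q\<close> replies to queries. Every step takes one unit of time.
  A configuration with command \<^const>\<open>Skip\<close> has halted and steps to itself.
\<close>

fun step :: "((nat \<Rightarrow> real) \<Rightarrow> real) \<Rightarrow> com \<Rightarrow> state \<Rightarrow> (com \<times> state) pmf" where
  "step Q Skip s = return_pmf (Skip, s)"
| "step Q (NAssign v e) s = return_pmf (Skip, s\<lparr>nvar := (nvar s)(v := nval e s)\<rparr>)"
| "step Q (RAssign v e) s = return_pmf (Skip, s\<lparr>rvar := (rvar s)(v := rval e s)\<rparr>)"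
| "step Q (Store a i e) s =
     return_pmf (Skip, s\<lparr>arr := (arr s)(a := (arr s a)(nval i s := rval e s))\<rparr>)"
| "step Q (Flip v e) s =
     map_pmf (\<lambda>b. (Skip, s\<lparr>rvar := (rvar s)(v := of_bool b)\<rparr>)) (bernoulli_pmf (rval e s))"
| "step Q (Query v a) s =
     return_pmf (Skip, s\<lparr>rvar := (rvar s)(v := Q (arr s a)), queries := Suc (queries s)\<rparr>)"
| "step Q (Seq c d) s =
     (if c = Skip then return_pmf (d, s)
      else map_pmf (\<lambda>(c', s'). (Seq c' d, s')) (step Q c s))"
| "step Q (If b c d) s = return_pmf (if bval b s then c else d, s)"
| "step Q (While b c) s = return_pmf (if bval b s then Seq c (While b c) else Skip, s)"

text \<open>Distribution of the configuration after \<open>t\<close> units of time.\<close>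

fun config_after ::
    "((nat \<Rightarrow> real) \<Rightarrow> real) \<Rightarrow> nat \<Rightarrow> com \<times> state \<Rightarrow> (com \<times> state) pmf" where
  "config_after Q 0 cf = return_pmf cf"
| "config_after Q (Suc t) cf = bind_pmf (config_after Q t cf) (\<lambda>(c, s). step Q c s)"

definition halted :: "com \<times> state \<Rightarrow> bool" where
  "halted cf \<longleftrightarrow> fst cf = Skip"

definition input_state :: "nat \<Rightarrow> real \<Rightarrow> real \<Rightarrow> real \<Rightarrow> state" where
  "input_state n p \<tau> \<delta> =
     \<lparr>nvar = (\<lambda>_. 0)(''n'' := n),
      rvar = (\<lambda>_. 0)(''p'' := p, ''tau'' := \<tau>, ''delta'' := \<delta>),
      arr = (\<lambda>_ _. 0),
      queries = 0\<rparr>"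

definition estimate :: "com \<times> state \<Rightarrow> nat \<Rightarrow> real" where
  "estimate cf i = arr (snd cf) ''eta'' i"

end

theory Submission
  imports Defs
begin

text \<open>
  For a noisy pair \<open>(x, y)\<close> the events \<open>x\<^sub>i = y\<^sub>i\<close> and \<open>x\<^sub>i \<noteq> y\<^sub>i\<close> have probabilities \<open>1 - p/2\<close> and
  \<open>p/2\<close>, and given \<open>x\<^sub>i = y\<^sub>i\<close> the common value is uniform and the other coordinates form a noisy
  pair. Hence \<open>Score\<^sub>i\<close> is the mean of \<open>[f x \<noteq> f y] (1 - [x\<^sub>i = y\<^sub>i] / (1 - p/2))\<close>, a variable with
  values in \<open>[-1, 1]\<close>. So the same two queries serve all \<open>i\<close>, and Hoeffding's inequality with a union
  bound shows that \<open>O(ln (n/\<delta>)/\<tau>\<^sup>2)\<close> samples suffice. The program has no logarithm: it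
  samples until \<open>(1 + \<tau>\<^sup>2/4)\<^sup>m \<ge> n/\<delta>\<close>.

  For \<open>n = 1\<close> sampling would not do, because \<open>ln (1/\<delta>)/\<tau>\<^sup>2\<close> can stay bounded while \<open>\<tau> \<rightarrow> 0\<close> and
  \<open>\<delta> \<rightarrow> 1\<close>; there the score is computed exactly from the two values of \<open>f\<close>.
\<close>

section \<open>Refinement of abstract samplers by programs\<close>

text \<open>\<open>config_after\<close> adds steps at the end of a run; symbolic execution has to
  peel them off at the front.\<close>

lemma config_after_Suc:
  "config_after Q (Suc t) (c, s) = bind_pmf (step Q c s) (config_after Q t)"
proof (induction t)
  case 0
  show ?case by (simp add: bind_return_pmf bind_return_pmf')
next
  case (Suc t)
  have "config_after Q (Suc (Suc t)) (c, s) =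
      bind_pmf (config_after Q (Suc t) (c, s)) (\<lambda>(c, s). step Q c s)"
    by simp
  also have "\<dots> = bind_pmf (step Q c s) (\<lambda>cf. bind_pmf (config_after Q t cf) (\<lambda>(c, s). step Q c s))"
    unfolding Suc.IH by (simp add: bind_assoc_pmf)
  finally show ?case by simp
qed

lemma config_after_Skip [simp]: "config_after Q t (Skip, s) = return_pmf (Skip, s)"
  by (induction t) (auto simp: bind_return_pmf)

lemma config_after_halted:
  assumes "\<forall>cf\<in>set_pmf (config_after Q T cf0). halted cf"
  shows "config_after Q (T + U) cf0 = config_after Q T cf0"
proof (induction U)
  case (Suc U)
  have "config_after Q (T + Suc U) cf0 = bind_pmf (config_after Q T cf0) (\<lambda>(c, s). step Q c s)"
    using Suc by simp
  also have "\<dots> = bind_pmf (config_after Q T cf0) return_pmf"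
    using assms by (intro bind_pmf_cong) (auto simp: halted_def)
  finally show ?case by (simp add: bind_return_pmf')
qed simp

text \<open>The extra unit is the step that discards the \<open>Skip\<close> left by
  \<open>c\<close>. On random branches where \<open>c\<close> halts before time \<open>T\<close>,
  \<open>d\<close> starts early and idles at the end, which does not change the
  distribution.\<close>

lemma config_after_Seq:
  assumes "\<forall>cf\<in>set_pmf (config_after Q T (c, s)). halted cf"
    and "\<And>s'. (Skip, s') \<in> set_pmf (config_after Q T (c, s)) \<Longrightarrow>
           \<forall>cf\<in>set_pmf (config_after Q U (d, s')). halted cf"
  shows "config_after Q (Suc (T + U)) (Seq c d, s) =
     bind_pmf (config_after Q T (c, s)) (\<lambda>(_, s'). config_after Q U (d, s'))"
  using assms
proof (induction T arbitrary: c s)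
  case 0
  then have "c = Skip" by (simp add: halted_def)
  then show ?case
    by (simp add: config_after_Suc bind_return_pmf del: config_after.simps(2))
next
  case (Suc T)
  show ?case
  proof (cases "c = Skip")
    case True
    \<comment> \<open>Here \<open>d\<close> receives \<open>Suc T\<close> surplus steps; having
      halted after \<open>U\<close>, it only repeats \<open>Skip\<close>.\<close>
    have "config_after Q (Suc (Suc T + U)) (Seq c d, s) = config_after Q (U + Suc T) (d, s)"
      using True
      by (simp add: config_after_Suc bind_return_pmf add.commute del: config_after.simps(2))
    also have "\<dots> = config_after Q U (d, s)"
      using Suc.prems(2)[of s] True by (intro config_after_halted) (auto simp del: config_after.simps(2))
    finally show ?thesis using True by (simp add: bind_return_pmf del: config_after.simps(2))
  next
    case False
    have "config_after Q (Suc (Suc T + U)) (Seq c d, s) =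
        bind_pmf (step Q c s) (\<lambda>(c', s'). config_after Q (Suc (T + U)) (Seq c' d, s'))"
      using False
      by (simp add: config_after_Suc[of Q "Suc (T + U)"] bind_map_pmf case_prod_beta'
            del: config_after.simps(2))
    also have "\<dots> = bind_pmf (step Q c s)
        (\<lambda>cf. bind_pmf (config_after Q T cf) (\<lambda>(_, s'). config_after Q U (d, s')))"
    proof (intro bind_pmf_cong refl)
      fix cf assume cf: "cf \<in> set_pmf (step Q c s)"
      obtain c' s' where eq: "cf = (c', s')" by (cases cf)
      have sub: "set_pmf (config_after Q T cf) \<subseteq> set_pmf (config_after Q (Suc T) (c, s))"
        using cf by (auto simp: config_after_Suc simp del: config_after.simps(2))
      show "(case cf of (c', s') \<Rightarrow> config_after Q (Suc (T + U)) (Seq c' d, s')) =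
          bind_pmf (config_after Q T cf) (\<lambda>(_, s'). config_after Q U (d, s'))"
        unfolding eq case_prod_conv
        by (intro Suc.IH) (use Suc.prems sub eq in blast)+
    qed
    finally show ?thesis
      by (simp add: config_after_Suc[of Q T] bind_assoc_pmf del: config_after.simps(2))
  qed
qed

text \<open>
  Within \<open>T\<close> steps \<open>c\<close> halts with a final state coupled by \<open>R\<close> to a sample of the abstract
  distribution \<open>M\<close>; \<open>R\<close> may leave the scratch variables unconstrained.
\<close>

definition refines ::
    "((nat \<Rightarrow> real) \<Rightarrow> real) \<Rightarrow> com \<Rightarrow> state \<Rightarrow> nat \<Rightarrow> 'a pmf \<Rightarrow> ('a \<Rightarrow> state \<Rightarrow> bool) \<Rightarrow> bool" where
  "refines Q c s T M R \<longleftrightarrow>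
     rel_pmf (\<lambda>a cf. halted cf \<and> R a (snd cf)) M (config_after Q T (c, s))"

section \<open>Coupling rules for single commands and sequences\<close>

lemma refines_ex:
  assumes "refines Q c s T M R" "cf \<in> set_pmf (config_after Q T (c, s))"
  shows "halted cf \<and> (\<exists>a\<in>set_pmf M. R a (snd cf))"
proof -
  obtain pq where pq: "\<And>a cf. (a, cf) \<in> set_pmf pq \<Longrightarrow> halted cf \<and> R a (snd cf)"
    "map_pmf fst pq = M" "map_pmf snd pq = config_after Q T (c, s)"
    using assms(1) unfolding refines_def by (auto elim!: rel_pmf.cases)
  from assms(2) obtain a where "(a, cf) \<in> set_pmf pq"
    unfolding pq(3)[symmetric] by auto
  moreover from this have "a \<in> set_pmf M"
    unfolding pq(2)[symmetric] by force
  ultimately show ?thesis using pq(1) by blast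
qed

lemma refines_mono:
  assumes "refines Q c s T M R" "T \<le> T'"
  shows "refines Q c s T' M R"
proof -
  have "config_after Q (T + (T' - T)) (c, s) = config_after Q T (c, s)"
    by (rule config_after_halted) (use refines_ex[OF assms(1)] in blast)
  then show ?thesis using assms unfolding refines_def by simp
qed

lemma refines_conseq:
  assumes "refines Q c s T M R" "\<And>a s. a \<in> set_pmf M \<Longrightarrow> R a s \<Longrightarrow> R' a s"
  shows "refines Q c s T M R'"
  using assms(1) unfolding refines_def by (rule pmf.rel_mono_strong) (use assms(2) in blast)

lemma refines_Skip: "R a s \<Longrightarrow> refines Q Skip s 0 (return_pmf a) R"
  by (simp add: refines_def halted_def)

lemma refines_map:
  assumes "refines Q c s T M (\<lambda>a. R (h a))"
  shows "refines Q c s T (map_pmf h M) R"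
  using assms by (simp add: refines_def pmf.rel_map)

lemma refines_step:
  assumes "step Q c s = return_pmf (c', s')" "refines Q c' s' T M R"
  shows "refines Q c s (Suc T) M R"
  using assms by (simp add: refines_def config_after_Suc bind_return_pmf del: config_after.simps(2))

text \<open>Couplings compose along \<open>bind_pmf\<close>. Only \<open>R\<close> is passed on to
  \<open>d\<close>, so whatever is needed later about the sample \<open>a\<close> must be recorded
  in \<open>R\<close>.\<close>

lemma refines_Seq:
  assumes "refines Q c s T M R" "\<And>a s'. R a s' \<Longrightarrow> refines Q d s' U (N a) R'"
  shows "refines Q (Seq c d) s (Suc (T + U)) (bind_pmf M N) R'"
proof -
  have "config_after Q (Suc (T + U)) (Seq c d, s) =
     bind_pmf (config_after Q T (c, s)) (\<lambda>(_, s'). config_after Q U (d, s'))"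
  proof (rule config_after_Seq)
    show "\<forall>cf\<in>set_pmf (config_after Q T (c, s)). halted cf"
      using refines_ex[OF assms(1)] by blast
    fix s' assume "(Skip, s') \<in> set_pmf (config_after Q T (c, s))"
    then obtain a where "R a s'" using refines_ex[OF assms(1)] by fastforce
    then show "\<forall>cf\<in>set_pmf (config_after Q U (d, s')). halted cf"
      using refines_ex[OF assms(2)] by blast
  qed
  then show ?thesis
    using assms unfolding refines_def by (auto intro!: rel_pmf_bindI)
qed

lemma refines_det:
  "step Q c s = return_pmf (Skip, s') \<Longrightarrow> R a s' \<Longrightarrow> refines Q c s 1 (return_pmf a) R"
  unfolding One_nat_def by (rule refines_step[OF _ refines_Skip])

lemma refines_Seq_det:
  assumes "step Q c s = return_pmf (Skip, s')" "refines Q d s' T M R"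
  shows "refines Q (Seq c d) s (Suc (Suc T)) M R"
proof -
  have "refines Q (Seq c d) s (Suc (1 + T)) (bind_pmf (return_pmf s') (\<lambda>_. M)) R"
    by (rule refines_Seq[OF refines_det[where R = "\<lambda>a t. a = s' \<and> t = s'", OF assms(1)]])
       (use assms(2) in auto)
  then show ?thesis by (simp add: bind_return_pmf)
qed

text \<open>Splits the analysis by the outcome of a coin. The separate equation for \<open>t\<close>
  lets the rule match a sampler syntactically and leaves the evaluation of \<open>e\<close> to the
  simplifier.\<close>

lemma refines_Seq_Flip:
  assumes "\<And>b. refines Q d (s\<lparr>rvar := (rvar s)(v := of_bool b)\<rparr>) T (N b) R"
    and "rval e s = t"
  shows "refines Q (Seq (Flip v e) d) s (Suc (Suc T)) (bind_pmf (bernoulli_pmf t) N) R"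
proof -
  have "refines Q (Flip v e) s 1 (bernoulli_pmf (rval e s))
      (\<lambda>b s'. s' = s\<lparr>rvar := (rvar s)(v := of_bool b)\<rparr>)"
    by (auto simp: refines_def halted_def bind_return_pmf pmf.rel_map intro!: rel_pmf_reflI)
  from refines_Seq[OF this, of d T N R] assms show ?thesis by simp
qed

text \<open>Symbolic execution of straight-line code: at most one rule fits each program, so
  repeated application computes the final state and sums up the time in a schematic
  variable.\<close>

lemmas refines_intros =
  refines_Seq_det[OF step.simps(2)] refines_Seq_det[OF step.simps(3)]
  refines_Seq_det[OF step.simps(4)] refines_Seq_det[OF step.simps(6)]
  refines_det[OF step.simps(2)] refines_det[OF step.simps(3)]
  refines_det[OF step.simps(4)] refines_det[OF step.simps(6)]
  refines_Seq_Flip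

text \<open>The invariant relates the state to the coordinates sampled so far, the others being \<open>d\<close>.\<close>

lemma refines_While_Pi:
  assumes body: "\<And>j a s. j < k \<Longrightarrow> I j a s \<Longrightarrow>
      bval b s \<and> refines Q c s T (p (Suc j)) (\<lambda>v. I (Suc j) (a(Suc j := v)))"
    and exit: "\<And>a s. I k a s \<Longrightarrow> \<not> bval b s"
    and start: "I 0 (\<lambda>_. d) s"
  shows "refines Q (While b c) s (k * (T + 2) + 1) (Pi_pmf {1..k} d p) (I k)"
proof -
  \<comment> \<open>Overlays the coordinates \<open>a\<close> drawn so far with the future ones
    \<open>g\<close>.\<close>
  let ?upd = "\<lambda>j a g i. if i \<in> {Suc j..k} then g i else a i"
  have "refines Q (While b c) s ((k - j) * (T + 2) + 1)
      (map_pmf (?upd j a) (Pi_pmf {Suc j..k} d p)) (I k)" if "j \<le> k" "I j a s" for j a s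
    using that
  \<comment> \<open>Downwards from \<open>k\<close>. Each iteration costs \<open>T + 2\<close>: the
    test, the body and the removal of its \<open>Skip\<close>; the last failing test costs
    1.\<close>
  proof (induction j arbitrary: a s rule: inc_induct)
    case base
    then show ?case using exit[of a s] by (auto intro!: refines_step refines_Skip)
  next
    case (step j)
    have ins: "{Suc j..k} = insert (Suc j) {Suc (Suc j)..k}" using step.hyps by auto
    \<comment> \<open>Independence lets coordinate \<open>Suc j\<close>, the one drawn by the
      current iteration, be split off the product.\<close>
    have "map_pmf (?upd j a) (Pi_pmf {Suc j..k} d p) =
        bind_pmf (p (Suc j)) (\<lambda>v. map_pmf (?upd (Suc j) (a(Suc j := v))) (Pi_pmf {Suc (Suc j)..k} d p))"
      unfolding ins
      by (subst Pi_pmf_insert')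
         (auto simp: map_bind_pmf map_pmf_def bind_assoc_pmf bind_return_pmf fun_eq_iff
            intro!: bind_pmf_cong)
    moreover have "refines Q (While b c) s (Suc (Suc (T + ((k - Suc j) * (T + 2) + 1))))
        (bind_pmf (p (Suc j)) (\<lambda>v. map_pmf (?upd (Suc j) (a(Suc j := v))) (Pi_pmf {Suc (Suc j)..k} d p)))
        (I k)"
    proof (rule refines_step[OF _ refines_Seq])
      show "refines Q c s T (p (Suc j)) (\<lambda>v. I (Suc j) (a(Suc j := v)))"
        using body[OF step.hyps(2) step.prems] by blast
    qed (use body[OF step.hyps(2) step.prems] step.IH in auto)
    moreover have "(k - j) * (T + 2) + 1 = Suc (Suc (T + ((k - Suc j) * (T + 2) + 1)))"
      using Suc_diff_Suc[OF step.hyps(2), symmetric] by simp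
    ultimately show ?case by (simp only:)
  qed
  from this[OF _ start] have "refines Q (While b c) s (k * (T + 2) + 1)
      (map_pmf (?upd 0 (\<lambda>_. d)) (Pi_pmf {1..k} d p)) (I k)" by simp
  \<comment> \<open>A sample of the product has the value \<open>d\<close> outside
    \<open>{1..k}\<close>, so overlaying the constant \<open>d\<close> changes nothing.\<close>
  moreover have "map_pmf (?upd 0 (\<lambda>_. d)) (Pi_pmf {1..k} d p) = map_pmf id (Pi_pmf {1..k} d p)"
    using subsetD[OF set_Pi_pmf_subset, of "{1..k}" _ d p]
    by (intro map_pmf_cong) (auto simp: fun_eq_iff)
  ultimately show ?thesis by simp
qed

text \<open>A loop without randomness is the case of point masses; collapsing the product to
  \<open>a\<close> lets a sample drawn earlier pass through the loop.\<close>

lemma refines_While_det: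
  assumes body: "\<And>j s. j < k \<Longrightarrow> I j s \<Longrightarrow>
      bval b s \<and> refines Q c s T (return_pmf a) (\<lambda>_. I (Suc j))"
    and exit: "\<And>s. I k s \<Longrightarrow> \<not> bval b s"
    and start: "I 0 s"
  shows "refines Q (While b c) s (k * (T + 2) + 1) (return_pmf a) (\<lambda>_. I k)"
proof -
  have "refines Q (While b c) s (k * (T + 2) + 1) (Pi_pmf {1..k} a (\<lambda>_. return_pmf a)) (\<lambda>_. I k)"
    by (rule refines_While_Pi) (use assms in auto)
  from refines_map[where h = "\<lambda>_. a" and R = "\<lambda>_. I k", OF this] show ?thesis by simp
qed

section \<open>Scores as expectations\<close>

text \<open>The law of one coordinate of a noisy pair. Coordinates are independent, so both
  conditioning on one of them and sampling them in turn become operations on a product.\<close>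

definition coord_pair :: "real \<Rightarrow> (real \<times> real) pmf" where
  "coord_pair p = bind_pmf (pmf_of_set {-1, 1}) (\<lambda>x. map_pmf (Pair x)
     (bind_pmf (bernoulli_pmf p) (\<lambda>r. if r then pmf_of_set {-1, 1} else return_pmf x)))"

text \<open>The default is a pair of \<open>undefined\<close> so that the projections
  \<open>fst \<circ> z\<close> and \<open>snd \<circ> z\<close> are extensional points of the
  cube.\<close>

abbreviation coord_pairs :: "nat set \<Rightarrow> real \<Rightarrow> (nat \<Rightarrow> real \<times> real) pmf" where
  "coord_pairs A p \<equiv> Pi_pmf A (undefined, undefined) (\<lambda>_. coord_pair p)"

lemma map_bernoulli_half_signs:
  "map_pmf (\<lambda>b. 2 * of_bool b - 1) (bernoulli_pmf (1 / 2)) = pmf_of_set {-1, 1 :: real}"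
  unfolding bernoulli_pmf_half_conv_pmf_of_set
  by (subst map_pmf_of_set_inj) (auto simp: inj_on_def UNIV_bool insert_commute)

text \<open>The form in which the program draws a coordinate: three coins in every case, the last
  ignored if \<open>r\<close> is false, with arithmetic in place of a branch.\<close>

lemma coord_pair_flips:
  "coord_pair p = bind_pmf (bernoulli_pmf (1 / 2)) (\<lambda>b. bind_pmf (bernoulli_pmf p) (\<lambda>r.
     bind_pmf (bernoulli_pmf (1 / 2)) (\<lambda>b'. return_pmf (2 * of_bool b - 1,
       of_bool r * (2 * of_bool b' - 1) + (1 - of_bool r) * (2 * of_bool b - 1)))))"
proof -
  have "(if r then pmf_of_set {-1, 1} else return_pmf x) =
      bind_pmf (bernoulli_pmf (1 / 2)) (\<lambda>b'. return_pmf (of_bool r * (2 * of_bool b' - 1) + (1 - of_bool r) * x))"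
    for r and x :: real
    by (cases r) (auto simp: map_bernoulli_half_signs[symmetric] map_pmf_def)
  then show ?thesis
    unfolding coord_pair_def map_bernoulli_half_signs[symmetric]
    by (simp add: map_pmf_def bind_assoc_pmf bind_return_pmf)
qed

lemma set_coord_pair: "set_pmf (coord_pair p) \<subseteq> {-1, 1} \<times> {-1, 1}"
  by (auto simp: coord_pair_def split: if_splits)

text \<open>Each equal pair has probability 1/2 * (1 - p + p/2) = 1/2 - p/4, each unequal pair 1/2 *
  p/2 = p/4.\<close>

lemma expectation_coord_pair_bind:
  fixes h :: "'a \<Rightarrow> real"
  assumes "p \<in> {0<..<1}" "\<And>v. finite (set_pmf (K v))"
  defines "E v \<equiv> measure_pmf.expectation (K v) h"
  shows "measure_pmf.expectation (bind_pmf (coord_pair p) K) h =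
     (1 / 2 - p / 4) * (E (1, 1) + E (-1, -1)) + p / 4 * (E (1, -1) + E (-1, 1))"
proof -
  have 1: "measure_pmf.expectation (bind_pmf (bernoulli_pmf t) L) h =
      t * measure_pmf.expectation (L True) h + (1 - t) * measure_pmf.expectation (L False) h"
    if "t \<in> {0<..<1}" "\<And>b. finite (set_pmf (L b))" for t and L :: "bool \<Rightarrow> 'a pmf"
    using that by (subst pmf_expectation_bind[of UNIV]) (auto simp: UNIV_bool)
  show ?thesis
    unfolding coord_pair_flips E_def using assms(1,2)
    by (simp add: bind_assoc_pmf bind_return_pmf 1 algebra_simps)
qed

text \<open>Drawing all of \<open>x\<close> and then all of \<open>y\<close> is the same as drawing
  the pairs coordinatewise, because a product of binds is a bind of products.\<close>

lemma noisy_pair_conv_coord_pairs: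
  "noisy_pair n p = map_pmf (\<lambda>z. (fst \<circ> z, snd \<circ> z)) (coord_pairs {1..n} p)"
proof -
  let ?A = "{1..n}" and ?u = "undefined :: real"
  let ?N = "\<lambda>x. bind_pmf (bernoulli_pmf p) (\<lambda>r. if r then pmf_of_set {-1, 1} else return_pmf (x :: real))"
  have cube: "pmf_of_set (cube n) = Pi_pmf ?A ?u (\<lambda>_. pmf_of_set {-1, 1})"
    unfolding cube_def by (subst Pi_pmf_of_set) (auto intro!: arg_cong[where f = pmf_of_set]
      simp: PiE_dflt_def PiE_def extensional_def)
  have "coord_pairs ?A p = bind_pmf (Pi_pmf ?A ?u (\<lambda>_. pmf_of_set {-1, 1}))
      (\<lambda>x. Pi_pmf ?A (?u, ?u) (\<lambda>i. bind_pmf (?N (x i)) (\<lambda>v. return_pmf (x i, v))))"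
    unfolding coord_pair_def map_pmf_def by (rule Pi_pmf_bind) simp
  also have "\<dots> = bind_pmf (Pi_pmf ?A ?u (\<lambda>_. pmf_of_set {-1, 1}))
      (\<lambda>x. bind_pmf (noisy_copy n p x) (\<lambda>y. return_pmf (\<lambda>i. if i \<in> ?A then (x i, y i) else (?u, ?u))))"
    unfolding noisy_copy_def by (subst Pi_pmf_bind[where d' = ?u]) auto
  finally have "map_pmf (\<lambda>z. (fst \<circ> z, snd \<circ> z)) (coord_pairs ?A p) =
      bind_pmf (Pi_pmf ?A ?u (\<lambda>_. pmf_of_set {-1, 1})) (\<lambda>x. map_pmf
       (\<lambda>y. (\<lambda>i. if i \<in> ?A then x i else ?u, \<lambda>i. if i \<in> ?A then y i else ?u)) (noisy_copy n p x))"
    by (simp add: map_bind_pmf map_pmf_def bind_assoc_pmf bind_return_pmf o_def if_distrib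
      cong: if_cong)
  also have "\<dots> = noisy_pair n p"
    unfolding noisy_pair_def cube
  \<comment> \<open>Points in the supports are already \<open>undefined\<close> outside
    \<open>{1..n}\<close>, so the truncation is the identity on them.\<close>
  proof (intro bind_pmf_cong refl map_pmf_cong)
    fix x y assume "x \<in> set_pmf (Pi_pmf ?A ?u (\<lambda>_. pmf_of_set {-1, 1}))" "y \<in> set_pmf (noisy_copy n p x)"
    then have "\<forall>i. i \<notin> ?A \<longrightarrow> x i = ?u \<and> y i = ?u"
      unfolding noisy_copy_def
      using set_Pi_pmf_subset[of ?A ?u "\<lambda>_. pmf_of_set {-1, 1}"]
        set_Pi_pmf_subset[of ?A ?u "\<lambda>i. ?N (x i)"] by auto
    then show "(\<lambda>i. if i \<in> ?A then x i else ?u, \<lambda>i. if i \<in> ?A then y i else ?u) = (x, y)"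
      by (auto simp: fun_eq_iff)
  qed
  finally show ?thesis by simp
qed

section \<open>Conditioning on one coordinate\<close>

lemma finite_set_coord_pairs: "finite A \<Longrightarrow> finite (set_pmf (coord_pairs A p))"
  by (subst set_Pi_pmf) (auto intro!: finite_PiE_dflt finite_subset[OF set_coord_pair])

text \<open>The conditional probability of f(x) \<noteq> f(y) given that coordinate \<open>i\<close>
  of the noisy pair is \<open>v\<close>; by independence the other coordinates keep their
  law.\<close>

definition disagree_prob ::
    "nat \<Rightarrow> real \<Rightarrow> ((nat \<Rightarrow> real) \<Rightarrow> real) \<Rightarrow> nat \<Rightarrow> real \<times> real \<Rightarrow> real" where
  "disagree_prob n p f i v = measure_pmf.expectation (coord_pairs ({1..n} - {i}) p)
     (\<lambda>z. of_bool (f (fst \<circ> z(i := v)) \<noteq> f (snd \<circ> z(i := v))))"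

lemma expectation_coord_pairs_split:
  fixes h :: "_ \<Rightarrow> real"
  assumes "i \<in> {1..n}" "p \<in> {0<..<1}"
  defines "E v \<equiv> measure_pmf.expectation (coord_pairs ({1..n} - {i}) p) (\<lambda>z. h (z(i := v)))"
  shows "measure_pmf.expectation (coord_pairs {1..n} p) h =
     (1 / 2 - p / 4) * (E (1, 1) + E (-1, -1)) + p / 4 * (E (1, -1) + E (-1, 1))"
proof -
  have "{1..n} = insert i ({1..n} - {i})" using assms by auto
  then have "coord_pairs {1..n} p = bind_pmf (coord_pair p) (\<lambda>v. map_pmf (\<lambda>z. z(i := v)) (coord_pairs ({1..n} - {i}) p))"
    using Pi_pmf_insert'[of "{1..n} - {i}" i] by (simp add: map_pmf_def)
  then show ?thesis
    using assms by (simp add: expectation_coord_pair_bind finite_set_coord_pairs)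
qed

lemma NS_conv_expectation:
  "NS n p f = measure_pmf.expectation (coord_pairs {1..n} p) (\<lambda>z. of_bool (f (fst \<circ> z) \<noteq> f (snd \<circ> z)))"
proof -
  have "NS n p f = measure_pmf.expectation (noisy_pair n p) (indicator {(x, y). f x \<noteq> f y})"
    unfolding NS_def by simp
  also have "\<dots> = measure_pmf.expectation (coord_pairs {1..n} p) (\<lambda>z. of_bool (f (fst \<circ> z) \<noteq> f (snd \<circ> z)))"
    unfolding noisy_pair_conv_coord_pairs
    by (subst integral_map_pmf) (auto intro!: Bochner_Integration.integral_cong simp: indicator_def)
  finally show ?thesis .
qed

text \<open>The restriction ignores coordinate \<open>i\<close>, so all four conditional terms
  coincide, and their weights add up to 1.\<close>

lemma NS_restriction:
  assumes "i \<in> {1..n}" "p \<in> {0<..<1}"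
  shows "NS n p (restriction f i b) = disagree_prob n p f i (b, b)"
proof -
  have "restriction f i b (fst \<circ> z(i := v)) = f (fst \<circ> z(i := (b, b)))"
    "restriction f i b (snd \<circ> z(i := v)) = f (snd \<circ> z(i := (b, b)))" for v and z :: "nat \<Rightarrow> real \<times> real"
    unfolding restriction_def by (auto intro!: arg_cong[where f = f])
  then show ?thesis
    unfolding NS_conv_expectation expectation_coord_pairs_split[OF assms] disagree_prob_def
    by (simp add: algebra_simps)
qed

text \<open>Equal pairs have weight 1/2 - p/4 in the noise sensitivity and 1/2 in the average over
  the restrictions, which leaves -p/4.\<close>

lemma Score_conv_disagree_prob:
  fixes f
  assumes "i \<in> {1..n}" "p \<in> {0<..<1}"
  defines "g \<equiv> disagree_prob n p f i"
  shows "Score n f p i = p / 4 * (g (1, -1) + g (-1, 1) - g (1, 1) - g (-1, -1))"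
proof -
  have "NS n p f = (1 / 2 - p / 4) * (g (1, 1) + g (-1, -1)) + p / 4 * (g (1, -1) + g (-1, 1))"
    unfolding NS_conv_expectation expectation_coord_pairs_split[OF assms(1,2)] g_def disagree_prob_def ..
  moreover have "measure_pmf.expectation (pmf_of_set {-1, 1}) (\<lambda>b. NS n p (restriction f i b)) =
      (g (1, 1) + g (-1, -1)) / 2"
    using assms by (simp add: NS_restriction integral_pmf_of_set g_def add.commute)
  ultimately show ?thesis unfolding Score_def by (simp add: field_simps)
qed

text \<open>On \<open>{-1, 1}\<close> the indicator of \<open>a = b\<close> is \<open>(1 + a * b) / 2\<close>.\<close>

definition score_sample ::
    "((nat \<Rightarrow> real) \<Rightarrow> real) \<Rightarrow> real \<Rightarrow> nat \<Rightarrow> (nat \<Rightarrow> real \<times> real) \<Rightarrow> real" where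
  "score_sample f p i z = (1 - f (fst \<circ> z) * f (snd \<circ> z)) / 2 * (1 - (1 + fst (z i) * snd (z i)) / (2 - p))"

lemma coord_pairs_cube:
  assumes "z \<in> set_pmf (coord_pairs {1..n} p)"
  shows "fst \<circ> z \<in> cube n" "snd \<circ> z \<in> cube n"
  using assms set_coord_pair[of p] unfolding cube_def
  by (auto simp: set_Pi_pmf PiE_dflt_def PiE_def extensional_def; fastforce)+

text \<open>The second factor is 1 if the two signs differ and -p/(2 - p), which exceeds -1, if they
  agree; the first is 0 or 1.\<close>

lemma score_sample_bounds:
  assumes "f \<in> cube n \<rightarrow> {-1, 1}" "i \<in> {1..n}" "p \<in> {0<..<1}" "z \<in> set_pmf (coord_pairs {1..n} p)"
  shows "score_sample f p i z \<in> {-1..1}"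
proof -
  note cube = coord_pairs_cube[OF assms(4)]
  have "f (fst \<circ> z) \<in> {-1, 1}" "f (snd \<circ> z) \<in> {-1, 1}"
    using cube assms(1) by blast+
  moreover have "fst (z i) \<in> {-1, 1}" "snd (z i) \<in> {-1, 1}"
    using PiE_mem[OF cube(1)[unfolded cube_def] assms(2)]
      PiE_mem[OF cube(2)[unfolded cube_def] assms(2)] by simp_all
  ultimately show ?thesis
    using assms(3) by (elim insertE emptyE) (simp_all add: score_sample_def divide_simps)
qed

text \<open>The factor -p/(2 - p) turns the weight (2 - p)/4 of an equal pair into -p/4, its
  coefficient in \<open>Score_conv_disagree_prob\<close>.\<close>

lemma expectation_score_sample:
  assumes "f \<in> cube n \<rightarrow> {-1, 1}" "i \<in> {1..n}" "p \<in> {0<..<1}"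
  shows "measure_pmf.expectation (coord_pairs {1..n} p) (score_sample f p i) = Score n f p i"
proof -
  let ?c = "\<lambda>v :: real \<times> real. 1 - (1 + fst v * snd v) / (2 - p)"
  let ?g = "disagree_prob n p f i"
  have "measure_pmf.expectation (coord_pairs {1..n} p) (score_sample f p i) =
     measure_pmf.expectation (coord_pairs {1..n} p)
       (\<lambda>z. of_bool (f (fst \<circ> z) \<noteq> f (snd \<circ> z)) * ?c (z i))"
  proof (intro integral_cong_AE)
    show "AE z in coord_pairs {1..n} p. score_sample f p i z =
        of_bool (f (fst \<circ> z) \<noteq> f (snd \<circ> z)) * ?c (z i)"
    proof (rule AE_pmfI)
      fix z assume "z \<in> set_pmf (coord_pairs {1..n} p)"
      then have "f (fst \<circ> z) \<in> {-1, 1}" "f (snd \<circ> z) \<in> {-1, 1}"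
        using coord_pairs_cube assms(1) by blast+
      then show "score_sample f p i z = of_bool (f (fst \<circ> z) \<noteq> f (snd \<circ> z)) * ?c (z i)"
        by (auto simp: score_sample_def)
    qed
  qed auto
  also have "\<dots> = (1 / 2 - p / 4) * (?g (1, 1) * ?c (1, 1) + ?g (-1, -1) * ?c (-1, -1)) +
      p / 4 * (?g (1, -1) * ?c (1, -1) + ?g (-1, 1) * ?c (-1, 1))"
    unfolding expectation_coord_pairs_split[OF assms(2,3)] disagree_prob_def by simp
  also have "\<dots> = Score n f p i"
    using assms(2,3) by (simp add: Score_conv_disagree_prob divide_simps) (simp add: algebra_simps)
  finally show ?thesis .
qed

text \<open>With no other coordinates, \<open>disagree_prob\<close> is an indicator: equal pairs
  contribute 0 and the two unequal ones p/4 each.\<close>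

lemma Score_one:
  assumes "p \<in> {0<..<1}" "f \<in> cube 1 \<rightarrow> {-1, 1}"
  shows "Score 1 f p 1 = (1 - f ((\<lambda>_. undefined)(1 := 1)) * f ((\<lambda>_. undefined)(1 := -1))) / 2 * (p / 2)"
proof -
  have "f ((\<lambda>_. undefined)(1 := 1)) \<in> {-1, 1}" "f ((\<lambda>_. undefined)(1 := -1)) \<in> {-1, 1}"
    using assms(2) by (auto simp: cube_def PiE_def extensional_def Pi_def)
  moreover have "disagree_prob 1 p f 1 (a, b) =
      of_bool (f ((\<lambda>_. undefined)(1 := a)) \<noteq> f ((\<lambda>_. undefined)(1 := b)))" for a b
  proof -
    have "fst \<circ> (\<lambda>_. (undefined, undefined))(1 := (a, b)) = (\<lambda>_ :: nat. undefined)(1 := a)"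
      "snd \<circ> (\<lambda>_. (undefined, undefined))(1 := (a, b)) = (\<lambda>_ :: nat. undefined)(1 := b)"
      by (auto simp: fun_eq_iff)
    moreover have "{1..1} - {1 :: nat} = {}" by simp
    ultimately show ?thesis unfolding disagree_prob_def by (simp only: pmf_Pi_empty) simp
  qed
  ultimately show ?thesis
    using Score_conv_disagree_prob[of 1 1 p f] assms(1) by (elim insertE emptyE) simp_all
qed

section \<open>Concentration of the sample means\<close>

lemma prob_mean_deviation:
  fixes X :: "'a \<Rightarrow> real" and Z :: "'a pmf"
  assumes "m > 0" "\<epsilon> \<ge> 0" "\<And>z. z \<in> set_pmf Z \<Longrightarrow> X z \<in> {-1..1}"
  shows "measure_pmf.prob (Pi_pmf {1..m} d (\<lambda>_. Z))
     {\<omega>. \<bar>(\<Sum>j = 1..m. X (\<omega> j)) / real m - measure_pmf.expectation Z X\<bar> \<ge> \<epsilon>}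
     \<le> 2 * exp (- real m * \<epsilon>\<^sup>2 / 2)"
proof -
  let ?M = "Pi_pmf {1..m} d (\<lambda>_. Z)"
  have comp: "map_pmf (\<lambda>\<omega>. \<omega> j) ?M = Z" if "j \<in> {1..m}" for j
    using that by (simp add: Pi_pmf_component)
  have distr: "distr (measure_pmf ?M) borel (\<lambda>\<omega>. X (\<omega> j)) = distr (measure_pmf Z) borel X"
    if "j \<in> {1..m}" for j
  proof -
    have "distr (measure_pmf (map_pmf (\<lambda>\<omega>. \<omega> j) ?M)) borel X = distr (measure_pmf ?M) borel (\<lambda>\<omega>. X (\<omega> j))"
      unfolding map_pmf_rep_eq by (subst distr_distr) (auto simp: o_def)
    then show ?thesis using comp[OF that] by simp
  qed
  \<comment> \<open>The first sample serves as the reference variable of the identically distributed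
    family.\<close>
  have one: "1 \<in> {1..m}" using assms(1) by simp
  interpret Hoeffding_ineq_iid ?M "{1..m}" "\<lambda>j \<omega>. X (\<omega> j)" "\<lambda>\<omega>. X (\<omega> 1)" "-1" 1
    "measure_pmf.expectation Z X"
  proof unfold_locales
    show "prob_space.indep_vars (measure_pmf ?M) (\<lambda>_. borel) (\<lambda>j \<omega>. X (\<omega> j)) {1..m}"
      by (intro prob_space.indep_vars_compose2[OF _ indep_vars_Pi_pmf])
        (auto simp: measure_pmf.prob_space_axioms)
    show "AE \<omega> in ?M. X (\<omega> 1) \<in> {-1..1}"
    proof (rule AE_pmfI)
      fix \<omega> assume "\<omega> \<in> set_pmf ?M"
      then have "\<omega> 1 \<in> set_pmf Z" using one by (auto simp: set_Pi_pmf PiE_dflt_def)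
      then show "X (\<omega> 1) \<in> {-1..1}" by (rule assms(3))
    qed
    have "measure_pmf.expectation Z X = measure_pmf.expectation ?M (\<lambda>\<omega>. X (\<omega> 1))"
      by (subst comp[OF one, symmetric]) simp
    then show "measure_pmf.expectation Z X \<equiv> measure_pmf.expectation ?M (\<lambda>\<omega>. X (\<omega> 1))"
      by simp
    show "distr (measure_pmf ?M) borel (\<lambda>\<omega>. X (\<omega> j)) =
        distr (measure_pmf ?M) borel (\<lambda>\<omega>. X (\<omega> 1))" if "j \<in> {1..m}" for j
      using distr[OF that] distr[OF one] by (rule trans[OF _ sym])
  qed simp_all
  have "measure_pmf.prob ?M {\<omega> \<in> space ?M.
      \<bar>(\<Sum>j = 1..m. X (\<omega> j)) / real (card {1..m}) - measure_pmf.expectation Z X\<bar> \<ge> \<epsilon>}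
      \<le> 2 * exp (- 2 * real (card {1..m}) * \<epsilon>\<^sup>2 / (1 - - 1)\<^sup>2)"
    by (rule Hoeffding_ineq_abs_ge'[OF assms(2)]) (use one in auto)
  \<comment> \<open>The range [-1, 1] has length 2, so Hoeffding's exponent is divided by 4.\<close>
  moreover have "- 2 * real (card {1..m}) * \<epsilon>\<^sup>2 / (1 - - 1)\<^sup>2 = - real m * \<epsilon>\<^sup>2 / 2"
    by simp
  ultimately show ?thesis by (simp only: space_measure_pmf UNIV_I simp_thms card_atLeastAtMost diff_Suc_1)
qed

text \<open>A union bound over \<open>i\<close>. It allows dependence between the estimates, so all
  of them may share the same samples.\<close>

lemma prob_all_scores:
  assumes "f \<in> cube n \<rightarrow> {-1, 1}" "p \<in> {0<..<1}" "m > 0" "\<tau> > 0"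
  shows "measure_pmf.prob (Pi_pmf {1..m} d (\<lambda>_. coord_pairs {1..n} p))
     {\<omega>. \<forall>i\<in>{1..n}. \<bar>(\<Sum>j = 1..m. score_sample f p i (\<omega> j)) / real m - Score n f p i\<bar> < \<tau>}
     \<ge> 1 - 2 * real n * exp (- real m * \<tau>\<^sup>2 / 2)"
proof -
  let ?M = "Pi_pmf {1..m} d (\<lambda>_. coord_pairs {1..n} p)"
  let ?B = "\<lambda>i. {\<omega>. \<bar>(\<Sum>j = 1..m. score_sample f p i (\<omega> j)) / real m - Score n f p i\<bar> \<ge> \<tau>}"
  have "measure_pmf.prob ?M (\<Union>i\<in>{1..n}. ?B i) \<le> (\<Sum>i = 1..n. measure_pmf.prob ?M (?B i))"
    by (rule measure_pmf.finite_measure_subadditive_finite) auto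
  also have "\<dots> \<le> (\<Sum>i = 1..n. 2 * exp (- real m * \<tau>\<^sup>2 / 2))"
  proof (rule sum_mono)
    fix i assume "i \<in> {1..n}"
    then have mean: "measure_pmf.expectation (coord_pairs {1..n} p) (score_sample f p i) = Score n f p i"
      and range: "\<And>z. z \<in> set_pmf (coord_pairs {1..n} p) \<Longrightarrow> score_sample f p i z \<in> {-1..1}"
      using expectation_score_sample score_sample_bounds assms(1,2) by blast+
    from prob_mean_deviation[where X = "score_sample f p i" and Z = "coord_pairs {1..n} p" and d = d,
      OF assms(3) less_imp_le[OF assms(4)] range]
    show "measure_pmf.prob ?M (?B i) \<le> 2 * exp (- real m * \<tau>\<^sup>2 / 2)"
      unfolding mean .
  qed
  finally have "measure_pmf.prob ?M (\<Union>i\<in>{1..n}. ?B i) \<le> 2 * real n * exp (- real m * \<tau>\<^sup>2 / 2)"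
    by simp
  moreover have "{\<omega>. \<forall>i\<in>{1..n}. \<bar>(\<Sum>j = 1..m. score_sample f p i (\<omega> j)) / real m - Score n f p i\<bar> < \<tau>}
      = space ?M - (\<Union>i\<in>{1..n}. ?B i)"
    by (auto simp only: not_le set_eq_iff mem_Collect_eq Diff_iff UN_iff space_measure_pmf UNIV_I)
      (use not_le in blast)+
  moreover have "measure_pmf.prob ?M (space ?M - (\<Union>i\<in>{1..n}. ?B i)) =
      1 - measure_pmf.prob ?M (\<Union>i\<in>{1..n}. ?B i)"
    by (rule measure_pmf.prob_compl) simp
  ultimately show ?thesis by (simp only:)
qed

section \<open>The number of samples\<close>

definition num_samples :: "nat \<Rightarrow> real \<Rightarrow> real \<Rightarrow> nat" where
  "num_samples n \<tau> \<delta> = (LEAST m. real n / \<delta> \<le> (1 + \<tau>\<^sup>2 / 4) ^ m)"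

text \<open>With y = \<tau>^2/4, the bounds y/2 \<le> ln (1 + y) \<le> y enclose \<open>m\<close>:
  the lower one limits the cost, the upper one the failure probability.\<close>

lemma num_samples:
  assumes "n \<ge> 2" "\<tau> \<in> {0<..<1}" "\<delta> \<in> {0<..<1}"
  defines "m \<equiv> num_samples n \<tau> \<delta>"
  shows "real n / \<delta> \<le> (1 + \<tau>\<^sup>2 / 4) ^ m"
    and "\<And>j. j < m \<Longrightarrow> (1 + \<tau>\<^sup>2 / 4) ^ j < real n / \<delta>"
    and "m > 0"
    and "m \<le> nat \<lceil>8 * ((ln (real n) + ln (1 / \<delta>)) / \<tau>\<^sup>2)\<rceil>"
    and "2 * real n * exp (- real m * \<tau>\<^sup>2 / 2) \<le> \<delta>"
proof -
  have "1 < 1 + \<tau>\<^sup>2 / 4" using assms(2) by simp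
  then have "\<exists>k. real n / \<delta> < (1 + \<tau>\<^sup>2 / 4) ^ k" by (rule real_arch_pow)
  then have "\<exists>k. real n / \<delta> \<le> (1 + \<tau>\<^sup>2 / 4) ^ k" using less_imp_le by blast
  then have ge: "real n / \<delta> \<le> (1 + \<tau>\<^sup>2 / 4) ^ m"
    unfolding m_def num_samples_def by (rule LeastI_ex)
  then show "real n / \<delta> \<le> (1 + \<tau>\<^sup>2 / 4) ^ m" .
  show less: "(1 + \<tau>\<^sup>2 / 4) ^ j < real n / \<delta>" if "j < m" for j
    using not_less_Least that unfolding m_def num_samples_def by (meson not_le)
  have gt1: "real n / \<delta> > 1" using assms by (simp add: field_simps)
  show pos: "m > 0" using ge gt1 by (cases "m = 0") auto
  define y where "y = \<tau>\<^sup>2 / 4"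
  have \<tau>2: "\<tau>\<^sup>2 < 1" using assms by (simp add: power_less_one_iff)
  have y: "0 < y" "y \<le> 1 / 2" using assms \<tau>2 by (auto simp: y_def)
  have L: "ln (real n / \<delta>) = ln (real n) + ln (1 / \<delta>)" using assms by (simp add: ln_div)
  have "y * y \<le> (1 / 2) * y" using y by (intro mult_right_mono) auto
  then have "y / 2 \<le> y - y\<^sup>2" by (simp add: power2_eq_square)
  also have "\<dots> \<le> ln (1 + y)" using y ln_one_plus_pos_lower_bound[of y] by simp
  finally have "real (m - 1) * (y / 2) \<le> real (m - 1) * ln (1 + y)" by (intro mult_left_mono) auto
  also have "\<dots> = ln ((1 + y) ^ (m - 1))" using y by (simp add: ln_realpow)
  also have "\<dots> < ln (real n / \<delta>)"
    using less[of "m - 1"] pos y(1) gt1 by (subst ln_less_cancel_iff) (simp_all add: y_def[symmetric])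
  \<comment> \<open>The stopping test still fails at \<open>m - 1\<close>, by minimality. The 8 is
    2/y times \<tau>^2.\<close>
  finally have "real (m - 1) < 8 * ((ln (real n) + ln (1 / \<delta>)) / \<tau>\<^sup>2)"
    using assms by (simp add: L y_def field_simps)
  then show "m \<le> nat \<lceil>8 * ((ln (real n) + ln (1 / \<delta>)) / \<tau>\<^sup>2)\<rceil>" using pos by linarith
  have "real n / \<delta> \<le> exp y ^ m"
    using ge y exp_ge_add_one_self[of y] power_mono[of "1 + y" "exp y" m] by (simp add: y_def)
  then have "real n / \<delta> \<le> exp (real m * y)" by (simp add: exp_of_nat_mult)
  \<comment> \<open>Twice the exponent my is the Hoeffding exponent m\<tau>^2/2, so the failure
    bound contains (\<delta>/n)^2 and not only \<delta>/n.\<close>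
  then have "(real n / \<delta>)\<^sup>2 \<le> (exp (real m * y))\<^sup>2" using gt1 by (intro power_mono) auto
  also have "\<dots> = exp (real m * \<tau>\<^sup>2 / 2)" by (simp add: power2_eq_square y_def flip: exp_add)
  finally have "exp (- real m * \<tau>\<^sup>2 / 2) \<le> (\<delta> / real n)\<^sup>2"
    using assms by (simp add: exp_minus field_simps)
  then have "2 * real n * exp (- real m * \<tau>\<^sup>2 / 2) \<le> 2 * real n * (\<delta> / real n)\<^sup>2"
    by (intro mult_left_mono) auto
  also have "\<dots> = (2 / real n) * \<delta> * \<delta>" using assms by (simp add: power2_eq_square)
  \<comment> \<open>Here n \<ge> 2 absorbs the factor 2 of the two-sided bound.\<close>
  also have "\<dots> \<le> 1 * 1 * \<delta>" using assms by (intro mult_mono) auto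
  finally show "2 * real n * exp (- real m * \<tau>\<^sup>2 / 2) \<le> \<delta>" by simp
qed

section \<open>The estimation program\<close>

abbreviation (input) half_disagreement :: rexp where
  "half_disagreement \<equiv> RDiv (RSub (RConst 1) (RMul (RVar ''fx'') (RVar ''fy''))) (RConst 2)"

definition sample_coord :: com where
  "sample_coord =
    Seq (NAssign ''i'' (NAdd (NVar ''i'') (NConst 1)))
   (Seq (Flip ''b'' (RDiv (RConst 1) (RConst 2)))
   (Seq (Store ''x'' (NVar ''i'') (RSub (RMul (RConst 2) (RVar ''b'')) (RConst 1)))
   (Seq (Flip ''r'' (RVar ''p''))
   (Seq (Flip ''b'' (RDiv (RConst 1) (RConst 2)))
        (Store ''y'' (NVar ''i'')
          (RAdd (RMul (RVar ''r'') (RSub (RMul (RConst 2) (RVar ''b'')) (RConst 1)))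
                (RMul (RSub (RConst 1) (RVar ''r'')) (RArr ''x'' (NVar ''i'')))))))))"

text \<open>A running mean: moving \<open>eta\<close> by 1/k of its distance to the new sample keeps
  it normalised without advance knowledge of the number of samples.\<close>

definition update_estimate :: com where
  "update_estimate =
    Seq (NAssign ''i'' (NAdd (NVar ''i'') (NConst 1)))
        (Store ''eta'' (NVar ''i'')
          (RAdd (RArr ''eta'' (NVar ''i''))
            (RDiv (RSub
              (RMul half_disagreement
                (RSub (RConst 1) (RDiv (RAdd (RConst 1)
                   (RMul (RArr ''x'' (NVar ''i'')) (RArr ''y'' (NVar ''i''))))
                  (RSub (RConst 2) (RVar ''p'')))))
              (RArr ''eta'' (NVar ''i''))) (RVar ''k''))))"

text \<open>Both queries stand outside the loops over \<open>i\<close>: two queries and O(n) time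
  per sample. The variable \<open>w\<close> replaces the logarithm in the stopping rule.\<close>

definition iteration :: com where
  "iteration =
    Seq (NAssign ''i'' (NConst 0))
   (Seq (While (NLess (NVar ''i'') (NVar ''n'')) sample_coord)
   (Seq (Query ''fx'' ''x'')
   (Seq (Query ''fy'' ''y'')
   (Seq (RAssign ''k'' (RAdd (RVar ''k'') (RConst 1)))
   (Seq (RAssign ''w'' (RMul (RVar ''w'')
          (RAdd (RConst 1) (RDiv (RMul (RVar ''tau'') (RVar ''tau'')) (RConst 4)))))
   (Seq (NAssign ''i'' (NConst 0))
        (While (NLess (NVar ''i'') (NVar ''n'')) update_estimate)))))))"

definition estimate_scores :: com where
  "estimate_scores =
    Seq (RAssign ''w'' (RConst 1))
        (While (RLess (RVar ''w'') (RDiv (RNat (NVar ''n'')) (RVar ''delta''))) iteration)"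

definition exact_score :: com where
  "exact_score =
    Seq (Store ''x'' (NConst 1) (RConst 1))
   (Seq (Query ''fx'' ''x'')
   (Seq (Store ''x'' (NConst 1) (RConst (-1)))
   (Seq (Query ''fy'' ''x'')
        (Store ''eta'' (NConst 1) (RMul half_disagreement (RDiv (RVar ''p'') (RConst 2)))))))"

definition score_program :: com where
  "score_program = If (NLess (NVar ''n'') (NConst 2)) exact_score estimate_scores"

section \<open>Loop invariants and running times\<close>

definition env :: "nat \<Rightarrow> real \<Rightarrow> real \<Rightarrow> real \<Rightarrow> (nat \<Rightarrow> real) \<Rightarrow> real \<Rightarrow> real \<Rightarrow> nat \<Rightarrow> state \<Rightarrow> bool" where
  "env n p \<tau> \<delta> e k w q s \<longleftrightarrow>
     nvar s ''n'' = n \<and> rvar s ''p'' = p \<and> rvar s ''tau'' = \<tau> \<and> rvar s ''delta'' = \<delta> \<and>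
     (\<forall>i\<in>{1..n}. arr s ''eta'' i = e i) \<and> rvar s ''k'' = k \<and> rvar s ''w'' = w \<and> queries s = q"

text \<open>Besides tying \<open>z\<close> to the arrays it records signs inside
  \<open>{1..j}\<close> and the default outside. Queries are answered by \<open>f\<close> only on
  the cube, and the coupling rules do not pass on the support of \<open>z\<close>.\<close>

definition sampled :: "nat \<Rightarrow> (nat \<Rightarrow> real \<times> real) \<Rightarrow> state \<Rightarrow> bool" where
  "sampled j z s \<longleftrightarrow>
     (\<forall>l. if l \<in> {1..j}
        then z l \<in> {-1, 1} \<times> {-1, 1} \<and> arr s ''x'' l = fst (z l) \<and> arr s ''y'' l = snd (z l)
        else z l = (undefined, undefined))"

lemma sampled_Suc:
  assumes "sampled j z s" "v \<in> {-1, 1} \<times> {-1, 1}"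
    and "arr s' ''x'' = (arr s ''x'')(Suc j := fst v)" "arr s' ''y'' = (arr s ''y'')(Suc j := snd v)"
  shows "sampled (Suc j) (z(Suc j := v)) s'"
  unfolding sampled_def
proof
  fix l
  consider "l \<in> {1..j}" | "l = Suc j" | "l \<notin> {1..Suc j}" by force
  then show "if l \<in> {1..Suc j}
      then (z(Suc j := v)) l \<in> {-1, 1} \<times> {-1, 1} \<and> arr s' ''x'' l = fst ((z(Suc j := v)) l) \<and>
        arr s' ''y'' l = snd ((z(Suc j := v)) l)
      else (z(Suc j := v)) l = (undefined, undefined)"
    using assms(1)[unfolded sampled_def, rule_format, of l] assms(2-4) by cases auto
qed

lemma sampled_frame [simp]:
  "sampled j z (s\<lparr>nvar := a\<rparr>) = sampled j z s"
  "sampled j z (s\<lparr>rvar := b\<rparr>) = sampled j z s"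
  "sampled j z (s\<lparr>queries := c\<rparr>) = sampled j z s"
  by (simp_all add: sampled_def)

lemma refines_sample_coord:
  assumes "env n p \<tau> \<delta> e k w q s" "nvar s ''i'' = j" "sampled j z s"
  shows "refines Q sample_coord s 11 (coord_pair p)
     (\<lambda>v s. env n p \<tau> \<delta> e k w q s \<and> nvar s ''i'' = Suc j \<and> sampled (Suc j) (z(Suc j := v)) s)"
  unfolding sample_coord_def coord_pair_flips
  \<comment> \<open>Five commands in sequence cost two units each and the last \<open>Store\<close>
    one, hence 11.\<close>
  apply (rule refines_mono, (rule refines_intros)+)
  using assms by (auto simp: env_def intro!: sampled_Suc)

lemma refines_sample_loop:
  assumes "env n p \<tau> \<delta> e k w q s" "nvar s ''i'' = 0"
  shows "refines Q (While (NLess (NVar ''i'') (NVar ''n'')) sample_coord) s (n * 13 + 1)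
     (coord_pairs {1..n} p) (\<lambda>z s. env n p \<tau> \<delta> e k w q s \<and> sampled n z s)"
proof -
  let ?I = "\<lambda>j z s. env n p \<tau> \<delta> e k w q s \<and> nvar s ''i'' = j \<and> sampled j z s"
  have "refines Q (While (NLess (NVar ''i'') (NVar ''n'')) sample_coord) s (n * (11 + 2) + 1)
     (coord_pairs {1..n} p) (?I n)"
  proof (rule refines_While_Pi[where I = ?I])
    fix j z s assume "j < n" "?I j z s"
    then show "bval (NLess (NVar ''i'') (NVar ''n'')) s \<and>
        refines Q sample_coord s 11 (coord_pair p) (\<lambda>v. ?I (Suc j) (z(Suc j := v)))"
      using refines_sample_coord[of n p \<tau> \<delta> e k w q s j z Q] by (simp add: env_def)
  next
    fix z s assume "?I n z s"
    then show "\<not> bval (NLess (NVar ''i'') (NVar ''n'')) s" by (simp add: env_def)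
  next
    show "?I 0 (\<lambda>_. (undefined, undefined)) s" using assms by (simp add: sampled_def)
  qed
  then have "refines Q (While (NLess (NVar ''i'') (NVar ''n'')) sample_coord) s (n * (11 + 2) + 1)
     (coord_pairs {1..n} p) (\<lambda>z s. env n p \<tau> \<delta> e k w q s \<and> sampled n z s)"
    by (rule refines_conseq) blast
  then show ?thesis by simp
qed

lemma reply_sampled:
  assumes "sampled n z s"
  shows "reply n f (arr s ''x'') = f (fst \<circ> z)" "reply n f (arr s ''y'') = f (snd \<circ> z)"
proof -
  have *: "if l \<in> {1..n}
      then z l \<in> {-1, 1} \<times> {-1, 1} \<and> arr s ''x'' l = fst (z l) \<and> arr s ''y'' l = snd (z l)
      else z l = (undefined, undefined)" for l
    using assms unfolding sampled_def by blast
  have "restrict (arr s ''x'') {1..n} = fst \<circ> z" "restrict (arr s ''y'') {1..n} = snd \<circ> z"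
    using * by (auto simp: fun_eq_iff restrict_def)
  moreover have "fst \<circ> z \<in> cube n \<and> snd \<circ> z \<in> cube n"
  proof -
    have "fst (z l) \<in> {-1, 1} \<and> snd (z l) \<in> {-1, 1}" if "l \<in> {1..n}" for l
      using *[of l] that by auto
    moreover have "fst (z l) = undefined \<and> snd (z l) = undefined" if "l \<notin> {1..n}" for l
      using *[of l] that by simp
    ultimately show ?thesis by (simp add: cube_def PiE_def Pi_def extensional_def)
  qed
  ultimately show "reply n f (arr s ''x'') = f (fst \<circ> z)" "reply n f (arr s ''y'') = f (snd \<circ> z)"
    by (simp_all add: reply_def Let_def)
qed

lemma refines_update_loop:
  assumes "env n p \<tau> \<delta> e k w q s" "nvar s ''i'' = 0" "sampled n z s"
    and "rvar s ''fx'' = f (fst \<circ> z)" "rvar s ''fy'' = f (snd \<circ> z)"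
  shows "refines Q (While (NLess (NVar ''i'') (NVar ''n'')) update_estimate) s (n * 5 + 1)
     (return_pmf z) (\<lambda>z. env n p \<tau> \<delta> (\<lambda>i. e i + (score_sample f p i z - e i) / k) k w q)"
proof -
  \<comment> \<open>The array in mid-update: cells up to \<open>j\<close> are new, the later ones
    still old.\<close>
  let ?e = "\<lambda>j i. if i \<le> j then e i + (score_sample f p i z - e i) / k else e i"
  let ?I = "\<lambda>j s. env n p \<tau> \<delta> (?e j) k w q s \<and> nvar s ''i'' = j \<and> sampled n z s \<and>
     rvar s ''fx'' = f (fst \<circ> z) \<and> rvar s ''fy'' = f (snd \<circ> z)"
  have "refines Q (While (NLess (NVar ''i'') (NVar ''n'')) update_estimate) s (n * (3 + 2) + 1)
     (return_pmf z) (\<lambda>_. ?I n)"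
  proof (rule refines_While_det[where I = ?I])
    fix j s assume "j < n" and I: "?I j s"
    have "refines Q update_estimate s 3 (return_pmf z) (\<lambda>_. ?I (Suc j))"
      unfolding update_estimate_def
      apply (rule refines_mono, (rule refines_intros)+)
      using \<open>j < n\<close> I by (auto simp: env_def sampled_def score_sample_def split: if_splits)
    then show "bval (NLess (NVar ''i'') (NVar ''n'')) s \<and>
        refines Q update_estimate s 3 (return_pmf z) (\<lambda>_. ?I (Suc j))"
      using \<open>j < n\<close> I by (simp add: env_def)
  next
    fix s assume "?I n s"
    then show "\<not> bval (NLess (NVar ''i'') (NVar ''n'')) s" by (simp add: env_def)
  next
    show "?I 0 s" using assms by (simp add: env_def)
  qed
  then have "refines Q (While (NLess (NVar ''i'') (NVar ''n'')) update_estimate) s (n * (3 + 2) + 1)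
     (return_pmf z) (\<lambda>z. env n p \<tau> \<delta> (\<lambda>i. e i + (score_sample f p i z - e i) / k) k w q)"
    by (rule refines_conseq) (simp add: env_def)
  then show ?thesis by simp
qed

lemma refines_iteration:
  assumes "env n p \<tau> \<delta> e k w q s"
  shows "refines (reply n f) iteration s (n * 18 + 15) (coord_pairs {1..n} p)
     (\<lambda>z. env n p \<tau> \<delta> (\<lambda>i. e i + (score_sample f p i z - e i) / (k + 1)) (k + 1)
        (w * (1 + \<tau>\<^sup>2 / 4)) (q + 2))"
proof -
  \<comment> \<open>After the sampling loop nothing is random, so the rest is coupled to the point
    mass at \<open>z\<close>.\<close>
  have tail: "refines (reply n f)
       (Seq (Query ''fx'' ''x'')
       (Seq (Query ''fy'' ''y'')
       (Seq (RAssign ''k'' (RAdd (RVar ''k'') (RConst 1)))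
       (Seq (RAssign ''w'' (RMul (RVar ''w'')
              (RAdd (RConst 1) (RDiv (RMul (RVar ''tau'') (RVar ''tau'')) (RConst 4)))))
       (Seq (NAssign ''i'' (NConst 0))
            (While (NLess (NVar ''i'') (NVar ''n'')) update_estimate)))))) s'
       (Suc (Suc (Suc (Suc (Suc (Suc (Suc (Suc (Suc (Suc (n * 5 + 1)))))))))))
       (return_pmf z)
       (\<lambda>z. env n p \<tau> \<delta> (\<lambda>i. e i + (score_sample f p i z - e i) / (k + 1)) (k + 1)
          (w * (1 + \<tau>\<^sup>2 / 4)) (q + 2))"
    if "env n p \<tau> \<delta> e k w q s' \<and> sampled n z s'" for z s'
    using that by (intro refines_intros refines_update_loop)
        (simp_all add: env_def reply_sampled[of n z s'] power2_eq_square)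
  have "refines (reply n f) iteration s (Suc (Suc (Suc (n * 13 + 1 +
       Suc (Suc (Suc (Suc (Suc (Suc (Suc (Suc (Suc (Suc (n * 5 + 1))))))))))))))
     (bind_pmf (coord_pairs {1..n} p) return_pmf)
     (\<lambda>z. env n p \<tau> \<delta> (\<lambda>i. e i + (score_sample f p i z - e i) / (k + 1)) (k + 1)
        (w * (1 + \<tau>\<^sup>2 / 4)) (q + 2))"
    unfolding iteration_def
    by (rule refines_Seq_det[OF step.simps(2) refines_Seq[OF refines_sample_loop tail]])
      (use assms in \<open>simp_all add: env_def\<close>)
  then show ?thesis unfolding bind_return_pmf' by (rule refines_mono) simp
qed

text \<open>For j = 0 the convention S / 0 = 0 matches the zeros initially stored in
  \<open>eta\<close>.\<close>

lemma running_mean: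
  "S / real j + (y - S / real j) / (real j + 1) = (S + y) / real (Suc j)" if "j = 0 \<Longrightarrow> S = 0"
proof (cases "j = 0")
  case False
  have "(S / real j + (y - S / real j) / (real j + 1)) * (real j + 1) =
      S / real j * (real j + 1) + (y - S / real j)"
    by (simp add: distrib_right)
  also have "\<dots> = S + y" using False by (simp add: field_simps)
  finally show ?thesis by (simp add: eq_divide_eq add.commute)
qed (use that in simp)

text \<open>The variable \<open>w\<close> evolves deterministically, so the loop runs exactly
  \<open>m\<close> times on every branch and its samples form a product of \<open>m\<close>
  independent copies.\<close>

lemma refines_estimate_scores:
  assumes "n \<ge> 2" "\<tau> \<in> {0<..<1}" "\<delta> \<in> {0<..<1}"
  defines "m \<equiv> num_samples n \<tau> \<delta>"
  shows "refines (reply n f) estimate_scores (input_state n p \<tau> \<delta>) (m * (n * 18 + 17) + 3)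
     (Pi_pmf {1..m} d (\<lambda>_. coord_pairs {1..n} p))
     (\<lambda>u s. (\<forall>i\<in>{1..n}. arr s ''eta'' i = (\<Sum>j = 1..m. score_sample f p i (u j)) / real m) \<and>
        queries s = 2 * m)"
proof -
  let ?e = "\<lambda>j u i. (\<Sum>l = 1..j. score_sample f p i (u l)) / real j"
  let ?I = "\<lambda>j u. env n p \<tau> \<delta> (?e j u) (real j) ((1 + \<tau>\<^sup>2 / 4) ^ j) (2 * j)"
  let ?b = "RLess (RVar ''w'') (RDiv (RNat (NVar ''n'')) (RVar ''delta''))"
  note m = num_samples[OF assms(1-3), folded m_def]
  have "refines (reply n f) estimate_scores (input_state n p \<tau> \<delta>)
     (Suc (Suc (m * ((n * 18 + 15) + 2) + 1))) (Pi_pmf {1..m} d (\<lambda>_. coord_pairs {1..n} p)) (?I m)"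
    unfolding estimate_scores_def
  proof (rule refines_Seq_det[OF step.simps(3) refines_While_Pi[where I = ?I]])
    fix j u s assume "j < m" and I: "?I j u s"
    have "?e j u i + (score_sample f p i z - ?e j u i) / (real j + 1) =
        ?e (Suc j) (u(Suc j := z)) i" for i z
    proof -
      have "(\<Sum>l = 1..j. score_sample f p i ((u(Suc j := z)) l)) = (\<Sum>l = 1..j. score_sample f p i (u l))"
        by (intro sum.cong) auto
      then show ?thesis
        using running_mean[of j "\<Sum>l = 1..j. score_sample f p i (u l)" "score_sample f p i z"] by simp
    qed
    then have "refines (reply n f) iteration s (n * 18 + 15) (coord_pairs {1..n} p)
        (\<lambda>z. ?I (Suc j) (u(Suc j := z)))"
      using refines_iteration[OF I, of f] by (simp add: algebra_simps)
    moreover have "bval ?b s" using I m(2)[OF \<open>j < m\<close>] by (simp add: env_def)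
    ultimately show "bval ?b s \<and> refines (reply n f) iteration s (n * 18 + 15) (coord_pairs {1..n} p)
        (\<lambda>z. ?I (Suc j) (u(Suc j := z)))" by blast
  next
    fix u s assume "?I m u s"
    then show "\<not> bval ?b s" using m(1) by (simp add: env_def)
  qed (simp add: env_def input_state_def)
  then have "refines (reply n f) estimate_scores (input_state n p \<tau> \<delta>)
     (Suc (Suc (m * ((n * 18 + 15) + 2) + 1))) (Pi_pmf {1..m} d (\<lambda>_. coord_pairs {1..n} p))
     (\<lambda>u s. (\<forall>i\<in>{1..n}. arr s ''eta'' i = (\<Sum>j = 1..m. score_sample f p i (u j)) / real m) \<and>
        queries s = 2 * m)"
    by (rule refines_conseq) (simp add: env_def)
  then show ?thesis by (rule refines_mono) simp
qed

section \<open>The case of a single coordinate\<close>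

lemma reply_one:
  assumes "a 1 \<in> {-1, 1}"
  shows "reply 1 f a = f ((\<lambda>_. undefined)(1 := a 1))"
proof -
  have "restrict a {1..1} = (\<lambda>_. undefined)(1 := a 1)" by (auto simp: fun_eq_iff)
  moreover have "(\<lambda>_. undefined)(1 := a 1) \<in> cube 1"
    using assms by (auto simp: cube_def PiE_def extensional_def)
  ultimately show ?thesis by (simp add: reply_def Let_def)
qed

lemma refines_exact_score:
  assumes "p \<in> {0<..<1}" "f \<in> cube 1 \<rightarrow> {-1, 1}"
  shows "refines (reply 1 f) exact_score (input_state 1 p \<tau> \<delta>) 9 (return_pmf ())
     (\<lambda>_ s. arr s ''eta'' 1 = Score 1 f p 1 \<and> queries s = 2)"
  unfolding exact_score_def Score_one[OF assms]
  by (rule refines_mono, (rule refines_intros)+)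
    (simp_all add: input_state_def reply_one[unfolded One_nat_def])

text \<open>Transfers a probability bound from samples to runs: the coupling carries the event
  \<open>G\<close> into \<open>H\<close>, so the probability can only grow.\<close>

lemma refines_estimates:
  assumes "refines Q P s T M R" "measure_pmf.prob M {a. G a} \<ge> 1 - \<delta>" "T \<le> T'"
    and "\<And>a s'. R a s' \<Longrightarrow> G a \<Longrightarrow> H s'" "\<And>a s'. R a s' \<Longrightarrow> queries s' \<le> B"
  shows "(\<forall>cf\<in>set_pmf (config_after Q T' (P, s)). halted cf \<and> queries (snd cf) \<le> B) \<and>
     measure_pmf.prob (config_after Q T' (P, s)) {cf. H (snd cf)} \<ge> 1 - \<delta>"
    (is "(\<forall>cf\<in>set_pmf ?D. _) \<and> _")
proof
  have R: "refines Q P s T' M R" by (rule refines_mono) fact+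
  show "\<forall>cf\<in>set_pmf ?D. halted cf \<and> queries (snd cf) \<le> B"
    \<comment> \<open>Halting and the query bound hold surely, so they come from the support of the
      coupling.\<close>
    using refines_ex[OF R] assms(5) by blast
  have "1 - \<delta> \<le> measure_pmf.prob M {a. G a}" by fact
  also have "\<dots> \<le> measure_pmf.prob ?D {cf. \<exists>a\<in>{a. G a}. halted cf \<and> R a (snd cf)}"
    using R unfolding refines_def by (rule rel_pmf_measureD)
  also have "\<dots> \<le> measure_pmf.prob ?D {cf. H (snd cf)}"
    using assms(4) by (intro measure_pmf.finite_measure_mono) auto
  finally show "measure_pmf.prob ?D {cf. H (snd cf)} \<ge> 1 - \<delta>" .
qed

section \<open>Assembly of the two cases\<close>

lemma score_program_correct:
  assumes "n \<ge> 1" "f \<in> cube n \<rightarrow> {-1, 1}" "p \<in> {0<..<1}" "\<tau> \<in> {0<..<1}" "\<delta> \<in> {0<..<1}"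
  defines "q \<equiv> nat \<lceil>8 * ((ln (real n) + ln (1 / \<delta>)) / \<tau>\<^sup>2)\<rceil>"
  defines "D \<equiv> config_after (reply n f) (40 * (q * n)) (score_program, input_state n p \<tau> \<delta>)"
  shows "(\<forall>cf\<in>set_pmf D. halted cf \<and> queries (snd cf) \<le> 40 * q) \<and>
     measure_pmf.prob D {cf. \<forall>i\<in>{1..n}. \<bar>arr (snd cf) ''eta'' i - Score n f p i\<bar> < \<tau>} \<ge> 1 - \<delta>"
proof -
  have "ln (real n) \<ge> 0" "ln (1 / \<delta>) > 0" using assms(1,5) by simp_all
  then have "8 * ((ln (real n) + ln (1 / \<delta>)) / \<tau>\<^sup>2) > 0" using assms(4) by simp
  \<comment> \<open>Since ln (1/\<delta>) > 0, rounding up leaves at least 1 even for n = 1; this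
    pays for the constant overhead.\<close>
  then have q: "q \<ge> 1" unfolding q_def by linarith
  show ?thesis
  proof (cases "n \<ge> 2")
    case True
    let ?m = "num_samples n \<tau> \<delta>" and ?d = "\<lambda>_. (undefined, undefined)"
    note m = num_samples[OF True assms(4,5)]
    have "refines (reply n f) score_program (input_state n p \<tau> \<delta>) (Suc (?m * (n * 18 + 17) + 3))
       (Pi_pmf {1..?m} ?d (\<lambda>_. coord_pairs {1..n} p))
       (\<lambda>u s. (\<forall>i\<in>{1..n}. arr s ''eta'' i = (\<Sum>j = 1..?m. score_sample f p i (u j)) / real ?m) \<and>
          queries s = 2 * ?m)"
      unfolding score_program_def
      by (rule refines_step[OF _ refines_estimate_scores[OF True assms(4,5)]])
        (use True in \<open>simp add: input_state_def\<close>)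
    moreover have "measure_pmf.prob (Pi_pmf {1..?m} ?d (\<lambda>_. coord_pairs {1..n} p))
        {u. \<forall>i\<in>{1..n}. \<bar>(\<Sum>j = 1..?m. score_sample f p i (u j)) / real ?m - Score n f p i\<bar> < \<tau>}
        \<ge> 1 - \<delta>"
      using prob_all_scores[OF assms(2,3) m(3), of \<tau> ?d] m(5) assms(4) by simp
    moreover have "Suc (?m * (n * 18 + 17) + 3) \<le> 40 * (q * n)"
    proof -
      \<comment> \<open>As n \<ge> 1, 18n + 17 \<le> 35n; the remaining 5qn of the budget 40qn cover
        the 4 steps outside the loop.\<close>
      have "?m * (n * 18 + 17) \<le> q * (n * 35)"
        using m(4) assms(1) unfolding q_def by (intro mult_le_mono) auto
      moreover have "1 * 1 \<le> q * n" using q assms(1) by (intro mult_le_mono)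
      ultimately show ?thesis by linarith
    qed
    ultimately show ?thesis
      unfolding D_def by (rule refines_estimates) (use m(4) in \<open>auto simp: q_def\<close>)
  next
    case False
    then have n: "n = 1" using assms(1) by simp
    have "refines (reply n f) score_program (input_state n p \<tau> \<delta>) (Suc 9) (return_pmf ())
       (\<lambda>_ s. arr s ''eta'' 1 = Score 1 f p 1 \<and> queries s = 2)"
      unfolding score_program_def n
      by (rule refines_step[OF _ refines_exact_score])
        (use assms(2,3) n in \<open>simp_all add: input_state_def\<close>)
    \<comment> \<open>The exact computation never fails, so the event is trivial.\<close>
    moreover have "measure_pmf.prob (return_pmf ()) {u. True} \<ge> 1 - \<delta>"
      using assms(5) by simp
    moreover have "Suc 9 \<le> 40 * (q * n)" using q n by simp
    ultimately show ?thesis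
      unfolding D_def by (rule refines_estimates) (use n q assms(4) in auto)
  qed
qed

theorem theorem3p11:
  shows "\<exists>(P :: com) (C :: real) (K :: nat). C > 0 \<and>
    (\<forall>(n :: nat) (f :: (nat \<Rightarrow> real) \<Rightarrow> real) (p :: real) (\<tau> :: real) (\<delta> :: real).
      n \<ge> 1 \<longrightarrow> f \<in> cube n \<rightarrow> {-1, 1} \<longrightarrow>
      p \<in> {0<..<1} \<longrightarrow> \<tau> \<in> {0<..<1} \<longrightarrow> \<delta> \<in> {0<..<1} \<longrightarrow>
      (let q = nat \<lceil>C * ((ln (real n) + ln (1 / \<delta>)) / \<tau>\<^sup>2)\<rceil>;
           D = config_after (reply n f) (K * (q * n)) (P, input_state n p \<tau> \<delta>)
       in (\<forall>cf \<in> set_pmf D. halted cf \<and> queries (snd cf) \<le> K * q) \<and>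
          measure_pmf.prob D {cf. \<forall>i\<in>{1..n}. \<bar>estimate cf i - Score n f p i\<bar> < \<tau>} \<ge> 1 - \<delta>))"
  unfolding Let_def estimate_def
  by (rule exI[of _ score_program], rule exI[of _ 8], rule exI[of _ 40], rule conjI, simp,
      intro allI impI, rule score_program_correct)

end
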